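(* There is an absolute constant $C>0$ such that for every integer $n>1$ and all $p,q\in[1,\infty]$ at least one of which does not exceed $2$, the couple $(n^{1/p}B_p,\ Cn^{1/q}B_q)$ of convex bodies in $\mathbb{R}^n$ admits concentration.
   Context: For $1\le p<\infty$, $B_p=\{x\in\mathbb{R}^n:\sum_{j=1}^n|x_j|^p\le1\}$, and $B_\infty=[-1,1]^n$; $n^{1/\infty}=1$. Fourier transform: $\hat F(t)=(2\pi)^{-n/2}\int_{\mathbb{R}^n}e^{-it\cdot x}F(x)\,dx$ (unitary on $L^2(\mathbb{R}^n)$). A couple $(S,K)$ of subsets of $\mathbb{R}^n$ admits concentration if there is a function $F\in L^2(\mathbb{R}^n)$ with $\|F\|_2=1$, $\|F\|_{L^2(K)}>\frac78$ and $\|\hat F\|_{L^2(S)}>\frac78$. *)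

theory Defs
  imports "HOL-Analysis.Analysis"
begin

text \<open>The dimension has to be bound by a quantifier inside a formula (the constant \<open>C\<close> does not
  depend on it), so the points of \<open>n\<close>-dimensional space are the extensional functions on
  \<open>{..<n}\<close>, and Lebesgue measure (on the Borel sets) is the product measure below.\<close>

definition lborel_n :: "nat \<Rightarrow> (nat \<Rightarrow> real) measure" where
  "lborel_n n = (\<Pi>\<^sub>M i\<in>{..<n}. lborel)"

definition in_L1 :: "nat \<Rightarrow> ((nat \<Rightarrow> real) \<Rightarrow> complex) \<Rightarrow> bool" where
  "in_L1 n F \<longleftrightarrow> integrable (lborel_n n) F"

definition in_L2 :: "nat \<Rightarrow> ((nat \<Rightarrow> real) \<Rightarrow> complex) \<Rightarrow> bool" where
  "in_L2 n F \<longleftrightarrow> F \<in> borel_measurable (lborel_n n) \<and> integrable (lborel_n n) (\<lambda>x. (cmod (F x))\<^sup>2)"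

text \<open>The norm of the space of square-integrable functions on \<open>A\<close>; it is meaningful for \<open>F\<close> in
  \<open>in_L2 n\<close> and measurable \<open>A\<close>, and the total norm is the case \<open>A = space (lborel_n n)\<close>.\<close>

definition L2_norm_on :: "nat \<Rightarrow> (nat \<Rightarrow> real) set \<Rightarrow> ((nat \<Rightarrow> real) \<Rightarrow> complex) \<Rightarrow> real" where
  "L2_norm_on n A F = sqrt (LINT x:A|lborel_n n. (cmod (F x))\<^sup>2)"

text \<open>Convergence in mean square, via the extended nonnegative integral so that a distance that is
  infinite is not mistaken for 0.\<close>

definition tendsto_L2 ::
    "nat \<Rightarrow> (nat \<Rightarrow> (nat \<Rightarrow> real) \<Rightarrow> complex) \<Rightarrow> ((nat \<Rightarrow> real) \<Rightarrow> complex) \<Rightarrow> bool" where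
  "tendsto_L2 n f F \<longleftrightarrow>
     (\<lambda>k. \<integral>\<^sup>+x. ennreal ((cmod (f k x - F x))\<^sup>2) \<partial>lborel_n n) \<longlonglongrightarrow> 0"

definition fourier :: "nat \<Rightarrow> ((nat \<Rightarrow> real) \<Rightarrow> complex) \<Rightarrow> (nat \<Rightarrow> real) \<Rightarrow> complex" where
  "fourier n F t = complex_of_real ((2 * pi) powr (- real n / 2)) *
     (LINT x|lborel_n n. exp (- \<i> * complex_of_real (\<Sum>j<n. t j * x j)) * F x)"

text \<open>The integral above need not converge for a square-integrable \<open>F\<close>. As usual, the transform is
  then the continuous (unitary) extension from the dense subspace of functions that are both integrable
  and square-integrable. It is stated as a relation between \<open>F\<close> and its transform \<open>G\<close>, which
  by Plancherel's theorem exists and is unique up to null sets.\<close>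

definition has_fourier_L2 ::
    "nat \<Rightarrow> ((nat \<Rightarrow> real) \<Rightarrow> complex) \<Rightarrow> ((nat \<Rightarrow> real) \<Rightarrow> complex) \<Rightarrow> bool" where
  "has_fourier_L2 n F G \<longleftrightarrow> in_L2 n F \<and> in_L2 n G \<and>
     (\<exists>f. (\<forall>k. in_L1 n (f k) \<and> in_L2 n (f k)) \<and>
          tendsto_L2 n f F \<and> tendsto_L2 n (\<lambda>k. fourier n (f k)) G)"

definition admits_concentration :: "nat \<Rightarrow> (nat \<Rightarrow> real) set \<Rightarrow> (nat \<Rightarrow> real) set \<Rightarrow> bool" where
  "admits_concentration n S K \<longleftrightarrow>
     (\<exists>F G. in_L2 n F \<and> has_fourier_L2 n F G \<and>
            L2_norm_on n (space (lborel_n n)) F = 1 \<and>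
            L2_norm_on n K F > 7 / 8 \<and> L2_norm_on n S G > 7 / 8)"

definition unit_ball_p :: "nat \<Rightarrow> ereal \<Rightarrow> (nat \<Rightarrow> real) set" where
  "unit_ball_p n p =
     (if p = \<infinity> then {x \<in> space (lborel_n n). \<forall>j<n. \<bar>x j\<bar> \<le> 1}
      else {x \<in> space (lborel_n n). (\<Sum>j<n. \<bar>x j\<bar> powr real_of_ereal p) \<le> 1})"

definition dim_root :: "nat \<Rightarrow> ereal \<Rightarrow> real" where
  "dim_root n p = (if p = \<infinity> then 1 else real n powr (1 / real_of_ereal p))"

definition dilate :: "nat \<Rightarrow> real \<Rightarrow> (nat \<Rightarrow> real) set \<Rightarrow> (nat \<Rightarrow> real) set" where
  "dilate n r A = (\<lambda>x. \<lambda>j\<in>{..<n}. r * x j) ` A"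

end

theory Submission
  imports Defs "HOL-Probability.Characteristic_Functions" "HOL-Probability.Sinc_Integral"
begin

text \<open>
  Power means order the bodies \<open>n\<^sup>1\<^sup>/\<^sup>p B\<^sub>p\<close>: they shrink as \<open>p\<close> grows. Each of them contains the cube
  \<open>[-1,1]\<^sup>n\<close>, and for \<open>p \<le> 2\<close> it contains the Euclidean ball of radius \<open>\<surd>n\<close>. Since one of the two
  exponents is at most 2, it is enough to concentrate one of the functions \<open>F\<close>, \<open>F^\<close> on a cube and
  the other one on a Euclidean ball, with half-side and radius \<open>1\<close> and \<open>\<surd>n\<close> up to the constant \<open>C\<close>.

  Tensor powers do this uniformly in \<open>n\<close>, because the transform of a tensor power is the tensor power
  of the transform (\<open>fourier_tensor_power\<close>). Let \<open>f\<close> be a function on the line with norm 1 and support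
  in \<open>[-1,1]\<close> whose transform \<open>h\<close> has a finite second moment \<open>s = \<integral> x\<^sup>2 |h(x)|\<^sup>2 dx\<close>. The tensor power
  of \<open>f\<close> lives entirely on the cube. The squared modulus of the tensor power of \<open>h\<close> is the
  density of \<open>n\<close> independent coordinates for which \<open>x\<^sub>1\<^sup>2 + \<dots> + x\<^sub>n\<^sup>2\<close> has expectation \<open>n s\<close>,
  so by Markov's inequality at most the proportion \<open>s / r\<^sup>2\<close> of its mass lies outside the ball of
  radius \<open>r \<surd>n\<close>, independently of \<open>n\<close>. A norm above \<open>7/8\<close> is mass above \<open>49/64\<close>, so \<open>s / r\<^sup>2 < 15/64\<close>
  suffices (\<open>L2_norm_on_tensor_power_cube\<close>, \<open>L2_norm_on_tensor_power_ball\<close>).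
  If \<open>q \<le> 2\<close>, take the tensor power of \<open>h\<close> on the space side and that of \<open>f\<close> on the frequency side,
  with \<open>r = C\<close>. If \<open>p \<le> 2\<close>, take the dilate of \<open>f\<close> supported in \<open>[-C,C]\<close> on the space side;
  the second moment of its transform is \<open>s / C\<^sup>2\<close>, and \<open>r = 1\<close>.

  For \<open>f\<close> the normalised parabola \<open>1 - y\<^sup>2\<close>, cut off at \<open>\<plusminus>1\<close>, is regular enough: its transform
  decays like \<open>1 / t\<^sup>2\<close>. The exchange of \<open>f\<close> and \<open>h\<close> needs
  Fourier inversion on the line, and the normalisation of \<open>h\<close> needs Plancherel's identity; both are
  proved for continuous bounded integrable functions with integrable transform, by Gaussian
  regularisation (\<open>fourier1_inversion\<close>, \<open>plancherel1\<close>).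
\<close>

section \<open>Fourier inversion and Plancherel's identity on the line\<close>

definition fourier1 :: "(real \<Rightarrow> complex) \<Rightarrow> real \<Rightarrow> complex" where
  "fourier1 f t = complex_of_real (1 / sqrt (2 * pi)) * (LINT x|lborel. cis (- (t * x)) * f x)"

lemma measurable_cis [measurable]: "cis \<in> borel_measurable borel"
  unfolding cis_conv_exp by measurable

lemma measurable_cnj [measurable]: "cnj \<in> borel_measurable borel"
  by (intro borel_measurable_continuous_onI continuous_intros)

lemma integrable_cis_mult:
  assumes "integrable M f" "g \<in> borel_measurable M"
  shows "integrable M (\<lambda>x. cis (g x) * f x)"
  by (rule Bochner_Integration.integrable_bound[OF assms(1)])
     (use assms in \<open>auto simp: norm_mult\<close>)

lemma fourier1_measurable [measurable]:
  assumes [measurable]: "f \<in> borel_measurable borel"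
  shows "fourier1 f \<in> borel_measurable borel"
  unfolding fourier1_def by measurable

text \<open>This is the characteristic function of the standard normal distribution, rescaled: the
  Gaussian weight that makes the inversion integral absolutely convergent transforms into
  \<open>2\<pi>\<close> times an approximate identity of width \<open>e\<close>.\<close>

lemma fourier1_gaussian:
  assumes "e > 0"
  shows "(LINT x|lborel. cis (s * x) * complex_of_real (exp (- ((e * x)\<^sup>2 / 2)))) =
    complex_of_real (2 * pi / e * std_normal_density (s / e))"
proof -
  have d: "exp (- ((e * x)\<^sup>2 / 2)) = sqrt (2 * pi) * std_normal_density (e * x)" for x
    by (simp add: std_normal_density_def)
  have "(LINT x|lborel. std_normal_density x *\<^sub>R cis (s / e * x)) = complex_of_real (exp (- (s / e)\<^sup>2 / 2))"
  proof -
    have "char std_normal_distribution (s / e) = (LINT x|lborel. std_normal_density x *\<^sub>R iexp (s / e * x))"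
      unfolding char_def by (subst integral_density) auto
    then show ?thesis
      by (simp add: cis_conv_exp char_std_normal_distribution)
  qed
  then have "(LINT x|lborel. std_normal_density (e * x) *\<^sub>R cis (s * x)) = complex_of_real (1 / e * exp (- (s / e)\<^sup>2 / 2))"
    using assms
    by (subst (asm) lborel_integral_real_affine[where c = e and t = 0])
       (auto simp: field_simps scaleR_conv_of_real)
  then have "(LINT x|lborel. sqrt (2 * pi) *\<^sub>R (std_normal_density (e * x) *\<^sub>R cis (s * x))) =
      complex_of_real (sqrt (2 * pi) * (1 / e * exp (- (s / e)\<^sup>2 / 2)))"
    by (simp only: integral_scaleR_right) (simp add: scaleR_conv_of_real)
  also have "sqrt (2 * pi) * (1 / e * exp (- (s / e)\<^sup>2 / 2)) = 2 * pi / e * std_normal_density (s / e)"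
  proof -
    have "2 * pi = sqrt (2 * pi) * sqrt (2 * pi)" by simp
    then show ?thesis by (simp add: std_normal_density_def divide_simps del: real_sqrt_mult)
  qed
  finally show ?thesis
    unfolding d by (simp add: scaleR_conv_of_real mult_ac)
qed

text \<open>Damp the inversion integral by the Gaussian weight \<open>exp (- (e x)\<^sup>2 / 2)\<close>. Fubini's theorem
  turns it into an average of \<open>g\<close> against a normal density of width \<open>e\<close> centred at \<open>- t\<close>. As \<open>e\<close> tends
  to 0, dominated convergence gives the undamped integral on one side (because the transform is
  integrable) and \<open>g (- t)\<close> on the other (because \<open>g\<close> is continuous and bounded).\<close>

theorem fourier1_inversion:
  fixes g :: "real \<Rightarrow> complex"
  assumes cont: "continuous_on UNIV g" and bound: "\<And>y. cmod (g y) \<le> B"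
    and int: "integrable lborel g" and int': "integrable lborel (fourier1 g)"
  shows "fourier1 (fourier1 g) t = g (- t)"
proof -
  define h where "h x = (LINT y|lborel. cis (- (x * y)) * g y)" for x
  have gm [measurable]: "g \<in> borel_measurable borel"
    using int by simp
  have hm [measurable]: "h \<in> borel_measurable borel"
    unfolding h_def by measurable
  define c where "c = complex_of_real (1 / sqrt (2 * pi))"
  have F: "fourier1 g = (\<lambda>x. c * h x)"
    by (simp add: fun_eq_iff fourier1_def h_def c_def)
  have inth: "integrable lborel h"
    using integrable_mult_right[OF int', of "complex_of_real (sqrt (2 * pi))"] by (simp add: F c_def)
  have reg: "(LINT x|lborel. cis (- (t * x)) * h x * complex_of_real (exp (- ((e * x)\<^sup>2 / 2)))) =
      2 * pi * (LINT v|lborel. std_normal_density v *\<^sub>R g (- t + e * v))" if e: "e > 0" for e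
  proof -
    have ig: "integrable lborel (\<lambda>x. exp (- ((e * x)\<^sup>2 / 2)))"
    proof -
      have "integrable lborel (\<lambda>x. sqrt (2 * pi) * std_normal_density (0 + e * x))"
        using e by (intro integrable_mult_right lborel_integrable_real_affine) auto
      then show ?thesis by (simp add: std_normal_density_def)
    qed
    have prod: "integrable (lborel \<Otimes>\<^sub>M lborel)
       (\<lambda>(x, y). cis (- (t + y) * x) * g y * complex_of_real (exp (- ((e * x)\<^sup>2 / 2))))"
      by (rule lborel_pair.Fubini_integrable)
         (auto simp: norm_mult mult.assoc split_beta' intro!: integrable_cis_mult integrable_mult_right integrable_mult_left ig int)
    have "(LINT x|lborel. cis (- (t * x)) * h x * complex_of_real (exp (- ((e * x)\<^sup>2 / 2)))) =
      (LINT x|lborel. LINT y|lborel. cis (- (t + y) * x) * g y * complex_of_real (exp (- ((e * x)\<^sup>2 / 2))))"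
    proof (intro Bochner_Integration.integral_cong refl)
      fix x
      have cc: "cis (- (t + y) * x) = cis (- (t * x)) * cis (- (x * y))" for y
        by (simp add: cis_mult algebra_simps)
      show "cis (- (t * x)) * h x * complex_of_real (exp (- ((e * x)\<^sup>2 / 2))) =
          (LINT y|lborel. cis (- (t + y) * x) * g y * complex_of_real (exp (- ((e * x)\<^sup>2 / 2))))"
        unfolding h_def cc mult.assoc[of "cis (- (t * x))"] by simp
    qed
    also have "\<dots> = (LINT y|lborel. LINT x|lborel. cis (- (t + y) * x) * g y * complex_of_real (exp (- ((e * x)\<^sup>2 / 2))))"
      by (rule lborel_pair.Fubini_integral[OF prod, symmetric])
    also have "\<dots> = (LINT y|lborel. g y * complex_of_real (2 * pi / e * std_normal_density (- (t + y) / e)))"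
      by (intro Bochner_Integration.integral_cong refl, subst fourier1_gaussian[OF e, symmetric])
         (simp flip: integral_mult_right_zero add: mult_ac)
    also have "\<dots> = e *\<^sub>R (LINT v|lborel. g (- t + e * v) * complex_of_real (2 * pi / e * std_normal_density (- v)))"
      using e by (subst lborel_integral_real_affine[where c = e and t = "- t"]) auto
    also have "\<dots> = 2 * pi * (LINT v|lborel. std_normal_density v *\<^sub>R g (- t + e * v))"
    proof -
      have "g (- t + e * v) * complex_of_real (2 * pi / e * std_normal_density (- v)) =
          complex_of_real (2 * pi / e) * (std_normal_density v *\<^sub>R g (- t + e * v))" for v
        by (simp add: scaleR_conv_of_real std_normal_density_def)
      then show ?thesis
        using e by (simp only: integral_mult_right_zero) (simp add: scaleR_conv_of_real)
    qed
    finally show ?thesis .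
  qed
  define e where "e k = inverse (real (Suc k))" for k
  have e0: "e \<longlonglongrightarrow> 0" and epos: "e k > 0" for k
    unfolding e_def using LIMSEQ_inverse_real_of_nat by auto
  have L1: "(\<lambda>k. LINT x|lborel. cis (- (t * x)) * h x * complex_of_real (exp (- ((e k * x)\<^sup>2 / 2)))) \<longlonglongrightarrow>
      (LINT x|lborel. cis (- (t * x)) * h x)"
  proof (rule integral_dominated_convergence[where w = "\<lambda>x. cmod (h x)"])
    show "AE x in lborel. (\<lambda>k. cis (- (t * x)) * h x * complex_of_real (exp (- ((e k * x)\<^sup>2 / 2)))) \<longlonglongrightarrow>
      cis (- (t * x)) * h x"
      by (auto intro!: tendsto_eq_intros e0)
  qed (use inth in \<open>auto simp: norm_mult intro!: mult_left_le\<close>)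
  have L2: "(\<lambda>k. LINT v|lborel. std_normal_density v *\<^sub>R g (- t + e k * v)) \<longlonglongrightarrow>
      (LINT v|lborel. std_normal_density v *\<^sub>R g (- t))"
  proof (rule integral_dominated_convergence[where w = "\<lambda>v. std_normal_density v * B"])
    have "(\<lambda>k. g (- t + e k * v)) \<longlonglongrightarrow> g (- t)" for v
    proof (rule continuous_on_tendsto_compose[OF cont])
      show "(\<lambda>k. - t + e k * v) \<longlonglongrightarrow> - t"
        by (auto intro!: tendsto_eq_intros e0)
    qed auto
    then show "AE v in lborel. (\<lambda>k. std_normal_density v *\<^sub>R g (- t + e k * v)) \<longlonglongrightarrow> std_normal_density v *\<^sub>R g (- t)"
      by (auto intro!: tendsto_intros)
  qed (use bound in \<open>auto intro!: mult_left_mono\<close>)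
  have "(LINT v|lborel. std_normal_density v *\<^sub>R g (- t)) = g (- t)"
    by (simp add: integral_normal_density)
  with L2 have "(\<lambda>k. 2 * pi * (LINT v|lborel. std_normal_density v *\<^sub>R g (- t + e k * v))) \<longlonglongrightarrow> 2 * pi * g (- t)"
    by (auto intro!: tendsto_intros)
  with L1 have "(LINT x|lborel. cis (- (t * x)) * h x) = 2 * pi * g (- t)"
    unfolding reg[OF epos] by (rule LIMSEQ_unique)
  moreover have "fourier1 (fourier1 g) t = c * c * (LINT x|lborel. cis (- (t * x)) * h x)"
    unfolding F by (subst fourier1_def) (simp flip: integral_mult_right_zero add: mult_ac c_def)
  moreover have "c * c = complex_of_real (1 / (2 * pi))"
    unfolding c_def of_real_mult[symmetric] by simp
  ultimately show ?thesis
    by simp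
qed

text \<open>Write one of the two factors of \<open>|fourier1 g|\<^sup>2\<close> as an integral, exchange the integrals, and
  recognise the inner one as the inversion integral.\<close>

theorem plancherel1:
  fixes g :: "real \<Rightarrow> complex"
  assumes cont: "continuous_on UNIV g" and bound: "\<And>y. cmod (g y) \<le> B"
    and int: "integrable lborel g" and int': "integrable lborel (fourier1 g)"
  shows "(LINT x|lborel. (cmod (fourier1 g x))\<^sup>2) = (LINT x|lborel. (cmod (g x))\<^sup>2)"
proof -
  define h where "h = fourier1 g"
  define c where "c = complex_of_real (1 / sqrt (2 * pi))"
  have gm [measurable]: "g \<in> borel_measurable borel"
    using int by simp
  have hm [measurable]: "h \<in> borel_measurable borel"
    unfolding h_def by measurable
  have inth: "integrable lborel h" using int' by (simp add: h_def)
  have prod: "integrable (lborel \<Otimes>\<^sub>M lborel) (\<lambda>(x, y). cis (x * y) * h x * (c * cnj (g y)))"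
    by (rule lborel_pair.Fubini_integrable)
       (auto simp: norm_mult mult.assoc split_beta'
          intro!: integrable_cis_mult integrable_mult_right integrable_mult_left int inth)
  have "complex_of_real (LINT x|lborel. (cmod (h x))\<^sup>2) = (LINT x|lborel. h x * cnj (h x))"
    by (simp only: integral_complex_of_real[symmetric] complex_norm_square)
  also have "\<dots> = (LINT x|lborel. LINT y|lborel. cis (x * y) * h x * (c * cnj (g y)))"
  proof (intro Bochner_Integration.integral_cong refl)
    fix x
    have "cnj (LINT y|lborel. cis (- (x * y)) * g y) = (LINT y|lborel. cnj (cis (- (x * y)) * g y))"
      by (rule Bochner_Integration.integral_cnj[symmetric])
    also have "\<dots> = (LINT y|lborel. cis (x * y) * cnj (g y))"
      by (intro Bochner_Integration.integral_cong refl) (simp add: cis_cnj)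
    finally have "cnj (h x) = c * (LINT y|lborel. cis (x * y) * cnj (g y))"
      by (simp add: h_def fourier1_def c_def)
    then show "h x * cnj (h x) = (LINT y|lborel. cis (x * y) * h x * (c * cnj (g y)))"
      by (simp flip: integral_mult_right_zero add: mult_ac)
  qed
  also have "\<dots> = (LINT y|lborel. LINT x|lborel. cis (x * y) * h x * (c * cnj (g y)))"
    by (rule lborel_pair.Fubini_integral[OF prod, symmetric])
  also have "\<dots> = (LINT y|lborel. fourier1 h (- y) * cnj (g y))"
    unfolding fourier1_def c_def
    by (intro Bochner_Integration.integral_cong refl)
       (simp flip: integral_mult_right_zero integral_mult_left_zero add: mult_ac)
  also have "\<dots> = (LINT y|lborel. g y * cnj (g y))"
    unfolding h_def by (subst fourier1_inversion[OF assms]) simp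
  also have "\<dots> = complex_of_real (LINT x|lborel. (cmod (g x))\<^sup>2)"
    by (simp only: integral_complex_of_real[symmetric] complex_norm_square)
  finally show ?thesis
    by (simp add: h_def)
qed

section \<open>A compactly supported function with a rapidly decaying transform\<close>

text \<open>A compactly supported function whose only irregularities are the two corners at \<open>\<plusminus>1\<close>, and
  whose transform can be computed from an elementary antiderivative.\<close>

definition bump :: "real \<Rightarrow> complex" where
  "bump y = complex_of_real (max 0 (1 - y\<^sup>2))"

lemma bump_eq_indicator: "bump y = indicator {-1..1} y *\<^sub>R complex_of_real (1 - y\<^sup>2)"
proof (cases "\<bar>y\<bar> \<le> 1")
  case True
  then have "y\<^sup>2 \<le> 1" by (simp add: abs_square_le_1)
  with True show ?thesis by (auto simp: bump_def indicator_def)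
next
  case False
  then have "y\<^sup>2 > 1" using one_less_power[of "\<bar>y\<bar>" 2] by simp
  with False show ?thesis by (auto simp: bump_def indicator_def)
qed

lemma continuous_bump: "continuous_on UNIV bump"
  unfolding bump_def by (intro continuous_intros)

lemma norm_bump_le: "cmod (bump y) \<le> 1"
  by (simp add: bump_def)

lemma bump_measurable [measurable]: "bump \<in> borel_measurable borel"
  by (rule borel_measurable_continuous_onI[OF continuous_bump])

lemma norm_bump_le_indicator: "cmod (bump y) \<le> indicator {-1..1} y"
  using norm_bump_le[of y] by (auto simp: bump_eq_indicator indicator_def)

lemma integrable_bump: "integrable lborel bump"
  by (rule Bochner_Integration.integrable_bound[where f = "indicator {-1..1::real} :: real \<Rightarrow> real"])
     (use norm_bump_le_indicator in auto)

lemma integral_bump_square: "0 < (LINT y|lborel. (cmod (bump y))\<^sup>2)"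
proof -
  have 1: "((LINT y|lborel. (1 - y\<^sup>2)\<^sup>2 * indicator {-1..1} y)) =
      (\<lambda>y::real. y - 2 / 3 * y ^ 3 + y ^ 5 / 5) 1 - (\<lambda>y::real. y - 2 / 3 * y ^ 3 + y ^ 5 / 5) (-1)"
    by (rule integral_FTC_Icc_real)
       (auto intro!: derivative_eq_intros continuous_intros simp: power2_eq_square algebra_simps eval_nat_numeral)
  have 2: "(cmod (bump y))\<^sup>2 = (1 - y\<^sup>2)\<^sup>2 * indicator {-1..1} y" for y
    by (simp only: bump_eq_indicator norm_scaleR norm_of_real power_mult_distrib)
       (simp add: indicator_def)
  show ?thesis unfolding 2 1 by simp
qed

text \<open>For \<open>\<bar>t\<bar> \<le> 1\<close> the trivial bound by the norm of \<open>bump\<close> in \<open>L\<^sup>1\<close> is enough. For larger \<open>t\<close> integrate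
  by parts twice: the boundary terms of order \<open>1 / t\<close> vanish because \<open>bump\<close> is 0 at
  \<open>\<plusminus>1\<close>, which leaves terms of order \<open>1 / t\<^sup>2\<close> and smaller.\<close>

lemma fourier1_bump_decay: "cmod (fourier1 bump t) \<le> 16 / (1 + t\<^sup>2)"
proof -
  define J where "J = (LINT y|lborel. cis (- (t * y)) * bump y)"
  have c: "1 / sqrt (2 * pi) \<le> 1"
    using pi_gt3 by simp
  have "cmod J \<le> 16 / (1 + t\<^sup>2)"
  proof (cases "\<bar>t\<bar> \<le> 1")
    case True
    have "cmod J \<le> (LINT y|lborel. cmod (cis (- (t * y)) * bump y))"
      unfolding J_def by (rule integral_norm_bound)
    also have "\<dots> \<le> (LINT y|lborel. indicator {-1..1::real} y)"
      by (rule integral_mono) (auto simp: norm_mult norm_bump_le_indicator integrable_bump)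
    also have "\<dots> = 2" by simp
    also have "2 \<le> 16 / (1 + t\<^sup>2)"
      using True abs_square_le_1[of t] by (simp add: pos_le_divide_eq add_pos_nonneg)
    finally show ?thesis .
  next
    case False
    then have t: "t\<^sup>2 > 1" "t \<noteq> 0" using one_less_power[of "\<bar>t\<bar>" 2] by auto
    define a where "a = - \<i> * complex_of_real t"
    have a: "a \<noteq> 0" "cmod a = \<bar>t\<bar>" using t by (auto simp: a_def norm_mult)
    \<comment> \<open>The antiderivative of \<open>exp (a y) p y\<close> is \<open>exp (a y) (p y / a - p' y / a\<^sup>2 + p'' y / a\<^sup>3)\<close> for a
      quadratic polynomial \<open>p\<close>, here \<open>p y = 1 - y\<^sup>2\<close>.\<close>
    define P where "P y = exp (a * complex_of_real y) *
      ((1 - complex_of_real y ^ 2) / a + 2 * complex_of_real y / a ^ 2 - 2 / a ^ 3)" for y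
    have "(LINT y|lborel. indicator {-1..1} y *\<^sub>R (exp (a * complex_of_real y) * complex_of_real (1 - y\<^sup>2))) = P 1 - P (-1)"
    proof (rule integral_FTC_Icc)
      fix x :: real
      show "(P has_vector_derivative exp (a * complex_of_real x) * complex_of_real (1 - x\<^sup>2)) (at x within {-1..1})"
        unfolding P_def
      proof (rule has_vector_derivative_real_field)
        let ?z = "complex_of_real x"
        have "a * (u / a + 2 * ?z / a ^ 2 - 2 / a ^ 3) = u + 2 * ?z / a - 2 / a ^ 2" for u
          using a(1) by (simp add: right_diff_distrib distrib_left power2_eq_square power3_eq_cube)
        then have "a * ((1 - ?z\<^sup>2) / a + 2 * ?z / a ^ 2 - 2 / a ^ 3) + (- (2 * ?z) / a + 2 / a ^ 2) = 1 - ?z\<^sup>2"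
          by simp
        moreover have "a * e * A + B * e = e * (a * A + B)" for e A B :: complex
          by (simp add: algebra_simps)
        ultimately have alg: "a * e * ((1 - ?z\<^sup>2) / a + 2 * ?z / a ^ 2 - 2 / a ^ 3) + (- (2 * ?z) / a + 2 / a ^ 2) * e = e * (1 - ?z\<^sup>2)" for e
          by simp
        have 1: "((\<lambda>z. exp (a * z)) has_field_derivative a * exp (a * ?z)) (at ?z)"
          by (auto intro!: derivative_eq_intros)
        have 2: "((\<lambda>z. (1 - z\<^sup>2) / a + 2 * z / a ^ 2 - 2 / a ^ 3) has_field_derivative - (2 * ?z) / a + 2 / a ^ 2) (at ?z)"
          using a(1) by (auto intro!: derivative_eq_intros simp: power4_eq_xxxx power2_eq_square)
        show "((\<lambda>z. exp (a * z) * ((1 - z\<^sup>2) / a + 2 * z / a ^ 2 - 2 / a ^ 3)) has_field_derivative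
            exp (a * ?z) * complex_of_real (1 - x\<^sup>2)) (at ?z)"
          using DERIV_mult[OF 1 2] unfolding alg by simp
      qed
    qed (auto intro!: continuous_intros)
    moreover have "J = (LINT y|lborel. indicator {-1..1} y *\<^sub>R (exp (a * complex_of_real y) * complex_of_real (1 - y\<^sup>2)))"
      unfolding J_def by (simp add: bump_eq_indicator cis_conv_exp a_def mult_ac)
    ultimately have J: "J = P 1 - P (-1)" by simp
    have "exp (a * complex_of_real y) = cis (- (t * y))" for y
      by (simp add: cis_conv_exp a_def mult_ac)
    then have ne: "cmod (exp (a * complex_of_real y)) = 1" for y by simp
    have P: "cmod (P y) \<le> 4 / t\<^sup>2" if "y = 1 \<or> y = -1" for y
    proof -
      have "cmod (P y) = cmod (2 * complex_of_real y / a ^ 2 - 2 / a ^ 3)"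
        using that ne by (auto simp: P_def norm_mult)
      also have "\<dots> \<le> cmod (2 * complex_of_real y / a ^ 2) + cmod (2 / a ^ 3)"
        by (rule norm_triangle_ineq4)
      also have "\<dots> = 2 / t\<^sup>2 + 2 / \<bar>t\<bar> ^ 3"
        using that by (auto simp: norm_mult norm_divide norm_power a)
      also have "2 / \<bar>t\<bar> ^ 3 \<le> 2 / t\<^sup>2"
        using False power_increasing[of 2 3 "\<bar>t\<bar>"] t by (intro divide_left_mono) auto
      finally show ?thesis by simp
    qed
    have "cmod J \<le> cmod (P 1) + cmod (P (-1))"
      unfolding J by (rule norm_triangle_ineq4)
    also have "\<dots> \<le> 8 / t\<^sup>2" using P[of 1] P[of "-1"] by simp
    also have "\<dots> \<le> 16 / (1 + t\<^sup>2)" using t by (simp add: field_simps)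
    finally show ?thesis .
  qed
  moreover have "cmod (fourier1 bump t) \<le> cmod J"
    using mult_right_mono[OF c norm_ge_zero[of J]]
    by (simp add: fourier1_def J_def norm_mult norm_divide)
  ultimately show ?thesis by simp
qed

lemma integrable_inverse_one_plus_square: "integrable lborel (\<lambda>x::real. inverse (1 + x\<^sup>2))"
  using integrable_inverse_1_plus_square by (simp add: set_integrable_def)

lemma integrable_fourier1_bump: "integrable lborel (fourier1 bump)"
  by (rule Bochner_Integration.integrable_bound[OF integrable_mult_right[OF integrable_inverse_one_plus_square, of 16]])
     (use fourier1_bump_decay in \<open>auto simp: divide_inverse\<close>)

text \<open>The transform decays like \<open>1 / x\<^sup>2\<close>, so the integrand is \<open>O(1 / x\<^sup>2)\<close>. This moment determines
  the absolute constant of the final theorem.\<close>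

lemma fourier1_bump_second_moment:
  "integrable lborel (\<lambda>x. x\<^sup>2 * (cmod (fourier1 bump x))\<^sup>2)"
proof (rule Bochner_Integration.integrable_bound[OF integrable_mult_right[OF integrable_inverse_one_plus_square, of "16\<^sup>2"]])
  have "x\<^sup>2 * (cmod (fourier1 bump x))\<^sup>2 \<le> 16\<^sup>2 * inverse (1 + x\<^sup>2)" for x :: real
  proof -
    have "x\<^sup>2 * (cmod (fourier1 bump x))\<^sup>2 \<le> (1 + x\<^sup>2) * (16 / (1 + x\<^sup>2))\<^sup>2"
      by (intro mult_mono power_mono fourier1_bump_decay) auto
    also have "\<dots> = 16\<^sup>2 * inverse (1 + x\<^sup>2)"
      using add_pos_nonneg[of 1 "x\<^sup>2"] by (simp add: power2_eq_square divide_simps)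
    finally show ?thesis .
  qed
  then show "AE x in lborel. norm (x\<^sup>2 * (cmod (fourier1 bump x))\<^sup>2) \<le> norm (16\<^sup>2 * inverse (1 + x\<^sup>2) :: real)"
    by auto
qed auto

text \<open>A unit vector of \<open>L\<^sup>2\<close> and its transform, which is again a unit vector. The relation is not
  symmetric: \<open>f\<close> is integrable, which makes the transform an absolutely convergent integral, while
  \<open>h\<close> is only square-integrable.\<close>

definition fourier_pair :: "(real \<Rightarrow> complex) \<Rightarrow> (real \<Rightarrow> complex) \<Rightarrow> bool" where
  "fourier_pair f h \<longleftrightarrow> integrable lborel f \<and> h \<in> borel_measurable borel \<and> fourier1 f = h \<and>
     has_bochner_integral lborel (\<lambda>x. (cmod (f x))\<^sup>2) 1 \<and>
     has_bochner_integral lborel (\<lambda>x. (cmod (h x))\<^sup>2) 1"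

lemma integrable_norm_square_of_bounded:
  fixes f :: "real \<Rightarrow> complex"
  assumes "integrable lborel f" "\<And>x. cmod (f x) \<le> B"
  shows "integrable lborel (\<lambda>x. (cmod (f x))\<^sup>2)"
proof (rule Bochner_Integration.integrable_bound)
  show "integrable lborel (\<lambda>x. B * cmod (f x))"
    using assms by auto
  have "(cmod (f x))\<^sup>2 \<le> B * cmod (f x)" for x
    using mult_right_mono[OF assms(2) norm_ge_zero[of "f x"]] by (simp add: power2_eq_square)
  then show "AE x in lborel. norm ((cmod (f x))\<^sup>2) \<le> norm (B * cmod (f x))"
    by (auto intro: order_trans[OF _ abs_ge_self])
  show "(\<lambda>x. (cmod (f x))\<^sup>2) \<in> borel_measurable lborel"
    using borel_measurable_integrable[OF assms(1)] by measurable
qed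

lemma fourier_pair_scale:
  assumes "fourier_pair f h" and c: "c > 0"
  shows "fourier_pair (\<lambda>x. complex_of_real (sqrt (1 / c)) * f (x / c)) (\<lambda>x. complex_of_real (sqrt c) * h (c * x))"
proof -
  have int: "integrable lborel f" and h [measurable]: "h \<in> borel_measurable borel" and fh: "fourier1 f = h"
    and f2: "has_bochner_integral lborel (\<lambda>x. (cmod (f x))\<^sup>2) 1"
    and h2: "has_bochner_integral lborel (\<lambda>x. (cmod (h x))\<^sup>2) 1"
    using assms by (auto simp: fourier_pair_def)
  have "integrable lborel (\<lambda>x. f (x / c))"
    using lborel_integrable_real_affine[OF int, of "1 / c" 0] c by simp
  moreover have "fourier1 (\<lambda>x. complex_of_real (sqrt (1 / c)) * f (x / c)) t = complex_of_real (sqrt c) * h (c * t)" for t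
  proof -
    have "(LINT x|lborel. cis (- (t * x)) * (complex_of_real (sqrt (1 / c)) * f (x / c))) =
        c *\<^sub>R (LINT x|lborel. cis (- (t * (c * x))) * (complex_of_real (sqrt (1 / c)) * f x))"
      using c by (subst lborel_integral_real_affine[where c = c and t = 0]) auto
    also have "\<dots> = complex_of_real (c * sqrt (1 / c)) * (LINT x|lborel. cis (- (c * t * x)) * f x)"
      by (simp flip: integral_mult_right_zero add: scaleR_conv_of_real mult_ac)
    also have "c * sqrt (1 / c) = sqrt c"
      using c by (simp add: real_sqrt_divide real_div_sqrt)
    finally show ?thesis
      by (simp add: fh[symmetric] fourier1_def mult_ac)
  qed
  moreover have "has_bochner_integral lborel (\<lambda>x. (cmod (complex_of_real (sqrt (1 / c)) * f (x / c)))\<^sup>2) 1"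
    using has_bochner_integral_mult_right[OF lborel_has_bochner_integral_real_affine_iff[THEN iffD1, OF _ f2, of "1 / c" 0], of "1 / c"] c
    by (simp add: norm_mult power_mult_distrib)
  moreover have "has_bochner_integral lborel (\<lambda>x. (cmod (complex_of_real (sqrt c) * h (c * x)))\<^sup>2) 1"
    using has_bochner_integral_mult_right[OF lborel_has_bochner_integral_real_affine_iff[THEN iffD1, OF _ h2, of c 0], of c] c
    by (simp add: norm_mult power_mult_distrib)
  ultimately show ?thesis
    unfolding fourier_pair_def by auto
qed

lemma scaled_second_moment:
  fixes h :: "real \<Rightarrow> complex"
  assumes "has_bochner_integral lborel (\<lambda>x. x\<^sup>2 * (cmod (h x))\<^sup>2) s" and c: "c > 0"
  shows "has_bochner_integral lborel (\<lambda>x. x\<^sup>2 * (cmod (complex_of_real (sqrt c) * h (c * x)))\<^sup>2) (s / c\<^sup>2)"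
proof -
  have "x\<^sup>2 * (cmod (complex_of_real (sqrt c) * h (c * x)))\<^sup>2 = 1 / c * ((0 + c * x)\<^sup>2 * (cmod (h (0 + c * x)))\<^sup>2)" for x
    using c by (simp add: norm_mult power_mult_distrib power2_eq_square[of c])
  then show ?thesis
    using has_bochner_integral_mult_right[OF lborel_has_bochner_integral_real_affine_iff[THEN iffD1, OF _ assms(1), of c 0], of "1 / c"] c
    by (simp add: power2_eq_square[of c] inverse_eq_divide)
qed

text \<open>The transform of an even function is inverted by the transform itself, so the normalised
  \<open>bump\<close> and its transform form a pair in both orders.\<close>

lemma ex_fourier_pair_both_orders:
  obtains f h s where "fourier_pair f h" "fourier_pair h f" "\<And>x. \<bar>x\<bar> > 1 \<Longrightarrow> f x = 0"
    "has_bochner_integral lborel (\<lambda>x. x\<^sup>2 * (cmod (h x))\<^sup>2) s"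
proof -
  define N where "N = (LINT y|lborel. (cmod (bump y))\<^sup>2)"
  have N: "N > 0" using integral_bump_square by (simp add: N_def)
  define c where "c = complex_of_real (1 / sqrt N)"
  have c2: "(cmod c)\<^sup>2 = 1 / N" using N by (simp add: c_def norm_divide power_divide)
  have F: "fourier1 (\<lambda>x. c * u x) t = c * fourier1 u t" for u t
    unfolding fourier1_def by (simp flip: integral_mult_right_zero add: mult_ac)
  define h where "h = fourier1 bump"
  have h: "integrable lborel h" unfolding h_def by (rule integrable_fourier1_bump)
  have hb: "cmod (h x) \<le> 16" for x
  proof -
    have "cmod (h x) \<le> 16 / (1 + x\<^sup>2)" unfolding h_def by (rule fourier1_bump_decay)
    also have "\<dots> \<le> 16" by (simp add: divide_le_eq add_pos_nonneg)
    finally show ?thesis .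
  qed
  have inv: "fourier1 h = bump"
    using fourier1_inversion[OF continuous_bump norm_bump_le integrable_bump h[unfolded h_def]]
    by (auto simp: h_def bump_def)
  have pl: "(LINT y|lborel. (cmod (h y))\<^sup>2) = N"
    using plancherel1[OF continuous_bump norm_bump_le integrable_bump h[unfolded h_def]]
    by (simp add: h_def N_def)
  have b2: "has_bochner_integral lborel (\<lambda>x. (cmod (c * bump x))\<^sup>2) 1"
    unfolding has_bochner_integral_iff norm_mult power_mult_distrib c2
    using N N_def integrable_norm_square_of_bounded[OF integrable_bump norm_bump_le] by simp
  have h2: "has_bochner_integral lborel (\<lambda>x. (cmod (c * h x))\<^sup>2) 1"
    unfolding has_bochner_integral_iff norm_mult power_mult_distrib c2
    using N pl integrable_norm_square_of_bounded[OF h hb] by simp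
  have mom: "integrable lborel (\<lambda>x. x\<^sup>2 * (cmod (c * h x))\<^sup>2)"
    using integrable_mult_right[OF fourier1_bump_second_moment, of "1 / N"]
    by (simp add: h_def norm_mult power_mult_distrib c2 mult_ac)
  show thesis
  proof (rule that)
    show "fourier_pair (\<lambda>x. c * bump x) (\<lambda>x. c * h x)"
      using h integrable_bump b2 h2 F unfolding fourier_pair_def
      by (auto simp: h_def)
    show "fourier_pair (\<lambda>x. c * h x) (\<lambda>x. c * bump x)"
      using h integrable_bump b2 h2 F unfolding fourier_pair_def
      by (auto simp: inv)
    show "c * bump x = 0" if "\<bar>x\<bar> > 1" for x
      using that by (auto simp: bump_eq_indicator indicator_def)
    show "has_bochner_integral lborel (\<lambda>x. x\<^sup>2 * (cmod (c * h x))\<^sup>2) (LINT x|lborel. x\<^sup>2 * (cmod (c * h x))\<^sup>2)"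
      using mom by (rule has_bochner_integral_integrable)
  qed
qed

section \<open>Tensor powers\<close>

definition tensor_power :: "nat \<Rightarrow> (real \<Rightarrow> complex) \<Rightarrow> (nat \<Rightarrow> real) \<Rightarrow> complex" where
  "tensor_power n f x = (\<Prod>j<n. f (x j))"

lemma has_bochner_integral_prod:
  fixes f :: "nat \<Rightarrow> real \<Rightarrow> 'b :: {real_normed_field,banach,second_countable_topology}"
  assumes "\<And>j. j < n \<Longrightarrow> has_bochner_integral lborel (f j) (I j)"
  shows "has_bochner_integral (lborel_n n) (\<lambda>x. \<Prod>j<n. f j (x j)) (\<Prod>j<n. I j)"
proof -
  interpret product_sigma_finite "\<lambda>_ :: nat. lborel :: real measure" ..
  have "integrable lborel (f j)" "integral\<^sup>L lborel (f j) = I j" if "j < n" for j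
    using assms[OF that] by (auto simp: has_bochner_integral_iff)
  then show ?thesis
    using product_integral_prod[of "{..<n}" f] product_integrable_prod[of "{..<n}" f]
    by (simp add: has_bochner_integral_iff lborel_n_def)
qed

lemma fourier_tensor_power:
  assumes "integrable lborel f"
  shows "fourier n (tensor_power n f) t = tensor_power n (fourier1 f) t"
proof -
  define k where "k j x = cis (- (t j * x)) * f x" for j x
  have 1: "exp (- \<i> * complex_of_real (\<Sum>j<n. t j * x j)) * tensor_power n f x = (\<Prod>j<n. k j (x j))" for x
    by (simp add: tensor_power_def k_def prod.distrib cis_conv_exp exp_sum[symmetric] sum_distrib_left sum_negf)
  have 2: "(LINT x|lborel_n n. (\<Prod>j<n. k j (x j))) = (\<Prod>j<n. integral\<^sup>L lborel (k j))"
  proof (rule has_bochner_integral_integral_eq, rule has_bochner_integral_prod)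
    show "has_bochner_integral lborel (k j) (integral\<^sup>L lborel (k j))" for j
      unfolding k_def using assms by (intro has_bochner_integral_integrable integrable_cis_mult) auto
  qed
  have "(1 / sqrt (2 * pi)) ^ n = ((2 * pi) powr (- 1 / 2)) powr real n"
    by (simp add: powr_realpow powr_minus_divide powr_half_sqrt)
  then have 3: "(2 * pi) powr (- real n / 2) = (1 / sqrt (2 * pi)) ^ n"
    by (simp add: powr_powr)
  show ?thesis
    unfolding fourier_def 1 2 3 unfolding tensor_power_def fourier1_def k_def
    by (simp only: prod.distrib prod_constant card_lessThan of_real_power)
qed

lemma tensor_power_norm_square:
  assumes "has_bochner_integral lborel (\<lambda>x. (cmod (f x))\<^sup>2) 1"
  shows "has_bochner_integral (lborel_n n) (\<lambda>x. (cmod (tensor_power n f x))\<^sup>2) 1"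
  using has_bochner_integral_prod[of n "\<lambda>_ x. (cmod (f x))\<^sup>2" "\<lambda>_. 1"] assms
  by (simp add: tensor_power_def prod_norm[symmetric] prod_power_distrib)

lemma tensor_power_measurable:
  assumes [measurable]: "f \<in> borel_measurable borel"
  shows "tensor_power n f \<in> borel_measurable (lborel_n n)"
  unfolding tensor_power_def lborel_n_def by measurable

text \<open>The first function is integrable, so its transform is a convergent integral and the constant
  sequence serves as the approximating sequence in the definition of the extended transform.\<close>

lemma has_fourier_L2_tensor_power:
  assumes "fourier_pair f h"
  shows "has_fourier_L2 n (tensor_power n f) (tensor_power n h)"
proof -
  have f: "integrable lborel f" "f \<in> borel_measurable borel" and h: "h \<in> borel_measurable borel" "fourier1 f = h"
    and "has_bochner_integral lborel (\<lambda>x. (cmod (f x))\<^sup>2) 1"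
      "has_bochner_integral lborel (\<lambda>x. (cmod (h x))\<^sup>2) 1"
    using assms by (auto simp: fourier_pair_def)
  then have "in_L2 n (tensor_power n f)" "in_L2 n (tensor_power n h)"
    using tensor_power_norm_square[of f n] tensor_power_norm_square[of h n]
    by (auto simp: in_L2_def tensor_power_measurable has_bochner_integral_iff)
  moreover have "in_L1 n (tensor_power n f)"
    using has_bochner_integral_prod[of n "\<lambda>_. f" "\<lambda>_. integral\<^sup>L lborel f"] f
    by (auto simp: in_L1_def tensor_power_def[abs_def] has_bochner_integral_iff)
  moreover have "fourier n (tensor_power n f) = tensor_power n h"
    using fourier_tensor_power[OF f(1)] h(2) by auto
  ultimately show ?thesis
    unfolding has_fourier_L2_def by (auto simp: tendsto_L2_def intro!: exI[of _ "\<lambda>_. tensor_power n f"])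
qed

lemma L2_norm_on_tensor_power_cube:
  assumes "has_bochner_integral lborel (\<lambda>x. (cmod (f x))\<^sup>2) 1" and supp: "\<And>x. \<bar>x\<bar> > r \<Longrightarrow> f x = 0"
    and A: "{x \<in> space (lborel_n n). \<forall>j<n. \<bar>x j\<bar> \<le> r} \<subseteq> A"
  shows "L2_norm_on n A (tensor_power n f) = 1"
proof -
  have "indicator A x *\<^sub>R (cmod (tensor_power n f x))\<^sup>2 = (cmod (tensor_power n f x))\<^sup>2" if sp: "x \<in> space (lborel_n n)" for x
  proof (cases "x \<in> A")
    case False
    then obtain j where "j < n" "\<bar>x j\<bar> > r" using A sp by force
    then have "tensor_power n f x = 0" using supp by (auto simp: tensor_power_def)
    then show ?thesis by simp
  qed auto
  then have "(LINT x:A|lborel_n n. (cmod (tensor_power n f x))\<^sup>2) = (LINT x|lborel_n n. (cmod (tensor_power n f x))\<^sup>2)"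
    unfolding set_lebesgue_integral_def by (intro Bochner_Integration.integral_cong refl)
  then show ?thesis
    using tensor_power_norm_square[OF assms(1), of n] by (simp add: L2_norm_on_def has_bochner_integral_iff)
qed

text \<open>Markov's inequality for the function \<open>x\<^sub>1\<^sup>2 + \<dots> + x\<^sub>n\<^sup>2\<close> under the probability density
  \<open>|tensor_power n f|\<^sup>2\<close>, under which each coordinate has second moment \<open>s\<close>. Both the expectation
  and the threshold are proportional to \<open>n\<close>, hence the dimension-free hypothesis.\<close>

lemma L2_norm_on_tensor_power_ball:
  assumes f2: "has_bochner_integral lborel (\<lambda>x. (cmod (f x))\<^sup>2) 1"
    and s: "has_bochner_integral lborel (\<lambda>x. x\<^sup>2 * (cmod (f x))\<^sup>2) s"
    and n: "n > 0" and r: "r > 0" and sr: "s / r\<^sup>2 < 15 / 64"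
    and A [measurable]: "A \<in> sets (lborel_n n)" and sub: "{x \<in> space (lborel_n n). (\<Sum>j<n. (x j)\<^sup>2) \<le> r\<^sup>2 * n} \<subseteq> A"
  shows "L2_norm_on n A (tensor_power n f) > 7 / 8"
proof -
  define m where "m x = (cmod (tensor_power n f x))\<^sup>2" for x
  have m: "has_bochner_integral (lborel_n n) m 1"
    unfolding m_def by (rule tensor_power_norm_square[OF f2])
  have "has_bochner_integral (lborel_n n) (\<lambda>x. (x j)\<^sup>2 * m x) s" if j: "j < n" for j
  proof -
    \<comment> \<open>The weight \<open>(x j)\<^sup>2\<close> only changes the factor of index \<open>j\<close>.\<close>
    have "has_bochner_integral (lborel_n n)
        (\<lambda>x. \<Prod>i<n. (if i = j then (x i)\<^sup>2 else 1) * (cmod (f (x i)))\<^sup>2) (\<Prod>i<n. if i = j then s else 1)"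
      using f2 s by (intro has_bochner_integral_prod[where f = "\<lambda>i y. (if i = j then y\<^sup>2 else 1) * (cmod (f y))\<^sup>2"]) auto
    then show ?thesis
      using j by (simp add: prod.distrib m_def tensor_power_def prod_norm[symmetric] prod_power_distrib)
  qed
  then have "has_bochner_integral (lborel_n n) (\<lambda>x. \<Sum>j<n. (x j)\<^sup>2 * m x) (\<Sum>j<n. s)"
    by (intro has_bochner_integral_sum) auto
  then have "has_bochner_integral (lborel_n n) (\<lambda>x. (1 / (r\<^sup>2 * n)) * ((\<Sum>j<n. (x j)\<^sup>2) * m x)) ((1 / (r\<^sup>2 * n)) * (n * s))"
    by (intro has_bochner_integral_mult_right) (simp add: sum_distrib_right)
  from has_bochner_integral_diff[OF m this]
  have I: "has_bochner_integral (lborel_n n) (\<lambda>x. m x - (1 / (r\<^sup>2 * n)) * ((\<Sum>j<n. (x j)\<^sup>2) * m x)) (1 - s / r\<^sup>2)"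
    using n by (simp add: field_simps)
  have "1 - s / r\<^sup>2 = (LINT x|lborel_n n. m x - (1 / (r\<^sup>2 * n)) * ((\<Sum>j<n. (x j)\<^sup>2) * m x))"
    using I by (simp add: has_bochner_integral_iff)
  also have "\<dots> \<le> (LINT x|lborel_n n. indicator A x *\<^sub>R m x)"
  proof (rule integral_mono)
    show "integrable (lborel_n n) (\<lambda>x. m x - (1 / (r\<^sup>2 * n)) * ((\<Sum>j<n. (x j)\<^sup>2) * m x))"
      using I by (simp add: has_bochner_integral_iff)
    show "integrable (lborel_n n) (\<lambda>x. indicator A x *\<^sub>R m x)"
      using m by (intro integrable_mult_indicator) (auto simp: has_bochner_integral_iff)
    fix x assume x: "x \<in> space (lborel_n n)"
    have m0: "m x \<ge> 0" by (simp add: m_def)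
    have rn: "r\<^sup>2 * n > 0" using r n by simp
    show "m x - (1 / (r\<^sup>2 * n)) * ((\<Sum>j<n. (x j)\<^sup>2) * m x) \<le> indicator A x *\<^sub>R m x"
    proof (cases "x \<in> A")
      case True
      then show ?thesis using m0 rn by (simp add: sum_nonneg)
    next
      case False
      then have "(\<Sum>j<n. (x j)\<^sup>2) > r\<^sup>2 * n" using sub x by force
      then have "1 \<le> (1 / (r\<^sup>2 * n)) * (\<Sum>j<n. (x j)\<^sup>2)" using rn by (simp add: field_simps)
      from mult_right_mono[OF this m0] False show ?thesis by (simp add: mult.assoc)
    qed
  qed
  finally have "(7 / 8)\<^sup>2 < (LINT x|lborel_n n. indicator A x *\<^sub>R m x)"
    using sr by (simp add: power2_eq_square)
  then show ?thesis
    unfolding L2_norm_on_def set_lebesgue_integral_def m_def by (rule real_less_rsqrt)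
qed


section \<open>Normalised \<open>p\<close>-balls\<close>

lemma dilate_Collect:
  assumes c: "c > 0"
  shows "dilate n c {x \<in> space (lborel_n n). P x} = {x \<in> space (lborel_n n). P (\<lambda>j\<in>{..<n}. x j / c)}"
proof (intro set_eqI iffI)
  fix y assume "y \<in> dilate n c {x \<in> space (lborel_n n). P x}"
  then obtain x where x: "x \<in> {..<n} \<rightarrow>\<^sub>E UNIV" "P x" and y: "y = (\<lambda>j\<in>{..<n}. c * x j)"
    by (auto simp: dilate_def lborel_n_def space_PiM)
  have "(\<lambda>j\<in>{..<n}. y j / c) = x"
    using x(1) c by (intro ext) (auto simp: y PiE_def extensional_def)
  then show "y \<in> {x \<in> space (lborel_n n). P (\<lambda>j\<in>{..<n}. x j / c)}"
    using x(2) by (simp add: lborel_n_def space_PiM y)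
next
  fix y assume "y \<in> {x \<in> space (lborel_n n). P (\<lambda>j\<in>{..<n}. x j / c)}"
  then have y: "y \<in> {..<n} \<rightarrow>\<^sub>E UNIV" "P (\<lambda>j\<in>{..<n}. y j / c)"
    by (auto simp: lborel_n_def space_PiM)
  define z where "z = (\<lambda>j\<in>{..<n}. y j / c)"
  have "y = (\<lambda>j\<in>{..<n}. c * z j)"
    using y(1) c by (intro ext) (auto simp: z_def PiE_def extensional_def)
  moreover have "z \<in> {x \<in> space (lborel_n n). P x}"
    using y(2) by (auto simp: z_def lborel_n_def space_PiM)
  ultimately show "y \<in> dilate n c {x \<in> space (lborel_n n). P x}"
    unfolding dilate_def by (rule image_eqI)
qed

lemma dilate_unit_ball_inf:
  assumes "r > 0"
  shows "dilate n (r * dim_root n \<infinity>) (unit_ball_p n \<infinity>) = {x \<in> space (lborel_n n). \<forall>j<n. \<bar>x j\<bar> \<le> r}"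
  using assms by (simp add: dim_root_def unit_ball_p_def dilate_Collect abs_divide)

lemma dilate_unit_ball_finite:
  assumes "r > 0" "n > 0" "p \<ge> 1"
  shows "dilate n (r * dim_root n (ereal p)) (unit_ball_p n (ereal p)) =
    {x \<in> space (lborel_n n). (\<Sum>j<n. (\<bar>x j\<bar> / r) powr p) \<le> n}"
proof -
  have "(\<bar>y\<bar> / (r * real n powr (1 / p))) powr p = (\<bar>y\<bar> / r) powr p / n" for y
    using assms by (simp add: powr_divide powr_mult powr_powr)
  then show ?thesis
    using assms by (simp add: dim_root_def unit_ball_p_def dilate_Collect abs_divide abs_mult
        sum_divide_distrib[symmetric] divide_le_eq)
qed

lemma ereal_ge_1_cases:
  fixes p :: ereal
  assumes "1 \<le> p"
  obtains "p = \<infinity>" | r where "p = ereal r" "r \<ge> 1"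
  using assms by (cases p) (auto simp: one_ereal_def)

lemma dilate_unit_ball_measurable:
  assumes "r > 0" "n > 0" "1 \<le> p"
  shows "dilate n (r * dim_root n p) (unit_ball_p n p) \<in> sets (lborel_n n)"
  using assms(3)
proof (cases rule: ereal_ge_1_cases)
  case 1
  show ?thesis
    unfolding 1 dilate_unit_ball_inf[OF assms(1)] lborel_n_def by measurable
next
  case (2 q)
  show ?thesis
    unfolding 2(1) dilate_unit_ball_finite[OF assms(1,2) 2(2)] lborel_n_def by measurable
qed

lemma cube_subset_dilate_unit_ball:
  assumes "r > 0" "n > 0" "1 \<le> p"
  shows "{x \<in> space (lborel_n n). \<forall>j<n. \<bar>x j\<bar> \<le> r} \<subseteq> dilate n (r * dim_root n p) (unit_ball_p n p)"
  using assms(3)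
proof (cases rule: ereal_ge_1_cases)
  case 1
  show ?thesis
    unfolding 1 dilate_unit_ball_inf[OF assms(1)] ..
next
  case (2 q)
  have "(\<Sum>j<n. (\<bar>x j\<bar> / r) powr q) \<le> n" if "\<forall>j<n. \<bar>x j\<bar> \<le> r" for x
  proof -
    have "(\<Sum>j<n. (\<bar>x j\<bar> / r) powr q) \<le> (\<Sum>j<n. 1)"
      using that assms(1) 2(2) by (intro sum_mono powr_le1) auto
    then show ?thesis by simp
  qed
  then show ?thesis
    unfolding 2(1) dilate_unit_ball_finite[OF assms(1,2) 2(2)] by auto
qed

text \<open>Weighted arithmetic-geometric mean inequality for \<open>u\<^sup>2\<close> and 1. The right-hand side averages to
  1 when the mean of \<open>u\<^sup>2\<close> is 1, which is the comparison of power means that the next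
  inclusion needs.\<close>

lemma powr_le_square_interpolation:
  fixes u q :: real
  assumes "0 \<le> u" "1 \<le> q" "q \<le> 2"
  shows "u powr q \<le> q / 2 * u\<^sup>2 + (1 - q / 2)"
proof (cases "u = 0")
  case False
  then have "(u\<^sup>2) powr (q / 2) * 1 powr (1 - q / 2) \<le> q / 2 * u\<^sup>2 + (1 - q / 2) * 1"
    using assms by (intro Youngs_inequality_0) auto
  moreover have "(u\<^sup>2) powr (q / 2) = u powr q"
    using assms False by (simp add: powr_powr flip: powr_numeral)
  ultimately show ?thesis by simp
qed (use assms in auto)

lemma euclidean_ball_subset_dilate_unit_ball:
  assumes "r > 0" "n > 0" "1 \<le> p" "p \<le> 2"
  shows "{x \<in> space (lborel_n n). (\<Sum>j<n. (x j)\<^sup>2) \<le> r\<^sup>2 * n} \<subseteq> dilate n (r * dim_root n p) (unit_ball_p n p)"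
  using assms(3)
proof (cases rule: ereal_ge_1_cases)
  case 1
  with assms(4) show ?thesis by simp
next
  case (2 q)
  then have q: "q \<le> 2" using assms(4) by (simp add: numeral_eq_ereal)
  have "(\<Sum>j<n. (\<bar>x j\<bar> / r) powr q) \<le> n" if x: "(\<Sum>j<n. (x j)\<^sup>2) \<le> r\<^sup>2 * n" for x
  proof -
    have "(\<Sum>j<n. (\<bar>x j\<bar> / r) powr q) \<le> (\<Sum>j<n. q / 2 * (\<bar>x j\<bar> / r)\<^sup>2 + (1 - q / 2))"
      using assms(1) 2(2) q by (intro sum_mono powr_le_square_interpolation) auto
    also have "\<dots> = q / 2 * ((\<Sum>j<n. (x j)\<^sup>2) / r\<^sup>2) + n * (1 - q / 2)"
      by (simp add: sum.distrib power_divide sum_distrib_left sum_divide_distrib)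
    also have "\<dots> \<le> q / 2 * n + n * (1 - q / 2)"
      using x assms(1) 2(2) by (intro add_right_mono mult_left_mono) (auto simp: divide_le_eq mult.commute)
    finally show ?thesis by (simp add: algebra_simps)
  qed
  then show ?thesis
    unfolding 2(1) dilate_unit_ball_finite[OF assms(1,2) 2(2)] by auto
qed

section \<open>Concentration\<close>

lemma admits_concentration_tensor_power:
  assumes "fourier_pair f h" "L2_norm_on n K (tensor_power n f) > 7 / 8" "L2_norm_on n S (tensor_power n h) > 7 / 8"
  shows "admits_concentration n S K"
proof -
  have "L2_norm_on n (space (lborel_n n)) (tensor_power n f) = 1"
    using tensor_power_norm_square[of f n] assms(1)
    by (simp add: L2_norm_on_def set_integral_space fourier_pair_def has_bochner_integral_iff)
  then show ?thesis
    using assms has_fourier_L2_tensor_power[OF assms(1), of n]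
    unfolding admits_concentration_def has_fourier_L2_def by blast
qed

theorem theorem5p3:
  "\<exists>C::real. C > 0 \<and>
     (\<forall>n::nat. n > 1 \<longrightarrow>
       (\<forall>p q::ereal. 1 \<le> p \<longrightarrow> 1 \<le> q \<longrightarrow> p \<le> 2 \<or> q \<le> 2 \<longrightarrow>
          admits_concentration n
            (dilate n (dim_root n p) (unit_ball_p n p))
            (dilate n (C * dim_root n q) (unit_ball_p n q))))"
proof -
  obtain f h s where fh: "fourier_pair f h" and hf: "fourier_pair h f"
    and supp: "\<And>x. \<bar>x\<bar> > 1 \<Longrightarrow> f x = 0"
    and s: "has_bochner_integral lborel (\<lambda>x. x\<^sup>2 * (cmod (h x))\<^sup>2) s"
    by (rule ex_fourier_pair_both_orders) blast
  have f2: "has_bochner_integral lborel (\<lambda>x. (cmod (f x))\<^sup>2) 1"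
    and h2: "has_bochner_integral lborel (\<lambda>x. (cmod (h x))\<^sup>2) 1"
    using fh by (auto simp: fourier_pair_def)
  have s0: "s \<ge> 0"
    using has_bochner_integral_integral_eq[OF s, symmetric] by simp
  \<comment> \<open>Any \<open>C\<close> with \<open>C\<^sup>2 > 64/15 s\<close> works; adding 1 keeps \<open>C\<close> visibly positive.\<close>
  define C where "C = sqrt (5 * s + 1)"
  have C: "C > 0" and C2: "C\<^sup>2 = 5 * s + 1" using s0 by (auto simp: C_def)
  have sC: "s / C\<^sup>2 < 15 / 64" unfolding C2 using s0 by (simp add: field_simps)
  show ?thesis
  proof (intro exI conjI allI impI)
    fix n :: nat and p q :: ereal
    assume n: "n > 1" and p: "1 \<le> p" and q: "1 \<le> q" and pq: "p \<le> 2 \<or> q \<le> 2"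
    define S where "S = dilate n (1 * dim_root n p) (unit_ball_p n p)"
    define K where "K = dilate n (C * dim_root n q) (unit_ball_p n q)"
    have "admits_concentration n S K"
      using pq
    proof
      assume p2: "p \<le> 2"
      define fC hC where "fC x = complex_of_real (sqrt (1 / C)) * f (x / C)"
        and "hC x = complex_of_real (sqrt C) * h (C * x)" for x
      have pair: "fourier_pair fC hC"
        unfolding fC_def hC_def by (rule fourier_pair_scale[OF fh C])
      have "L2_norm_on n K (tensor_power n fC) = 1"
      proof (rule L2_norm_on_tensor_power_cube[where r = C])
        show "fC x = 0" if "\<bar>x\<bar> > C" for x
          using that C by (simp add: fC_def supp abs_divide)
        show "{x \<in> space (lborel_n n). \<forall>j<n. \<bar>x j\<bar> \<le> C} \<subseteq> K"
          unfolding K_def using C n q by (intro cube_subset_dilate_unit_ball) auto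
      qed (use pair in \<open>simp add: fourier_pair_def\<close>)
      moreover have "L2_norm_on n S (tensor_power n hC) > 7 / 8"
      proof (rule L2_norm_on_tensor_power_ball[where r = 1])
        show "has_bochner_integral lborel (\<lambda>x. x\<^sup>2 * (cmod (hC x))\<^sup>2) (s / C\<^sup>2)"
          unfolding hC_def by (rule scaled_second_moment[OF s C])
        show "{x \<in> space (lborel_n n). (\<Sum>j<n. (x j)\<^sup>2) \<le> 1\<^sup>2 * real n} \<subseteq> S"
          unfolding S_def using n p p2 by (intro euclidean_ball_subset_dilate_unit_ball) auto
        show "S \<in> sets (lborel_n n)"
          unfolding S_def using n p by (intro dilate_unit_ball_measurable) auto
      qed (use pair sC n in \<open>auto simp: fourier_pair_def\<close>)
      ultimately show ?thesis
        by (intro admits_concentration_tensor_power[OF pair]) simp_all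
    next
      assume q2: "q \<le> 2"
      have "L2_norm_on n S (tensor_power n f) = 1"
        unfolding S_def using n p supp
        by (intro L2_norm_on_tensor_power_cube[OF f2, where r = 1] cube_subset_dilate_unit_ball) auto
      moreover have "L2_norm_on n K (tensor_power n h) > 7 / 8"
        unfolding K_def using n q q2 C sC
        by (intro L2_norm_on_tensor_power_ball[OF h2 s, where r = C]
            dilate_unit_ball_measurable euclidean_ball_subset_dilate_unit_ball) auto
      ultimately show ?thesis
        by (intro admits_concentration_tensor_power[OF hf]) simp_all
    qed
    then show "admits_concentration n (dilate n (dim_root n p) (unit_ball_p n p))
        (dilate n (C * dim_root n q) (unit_ball_p n q))"
      by (simp add: S_def K_def)
  qed (rule C)
qed

end
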